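(* Let $p$ be a prime, let $k \in \mathbb{N}$, let $\alpha_1,\ldots,\alpha_k \in \mathbb{N}_0$, and let $\beta \in \mathbb{N}_0$. Let $A := \prod_{i=1}^k \mathbb{Z}_{p^{\alpha_i}}$, let $B$ be an abelian group of exponent $p^{\beta}$, and let $f : A \to B$ be a function. Then $$\operatorname{Fdeg}(f) \le \beta \sum_{i=1}^k (p^{\alpha_i} - 1).$$
   Context: $\mathbb{N}$ is the set of positive integers, $\mathbb{N}_0 = \mathbb{N} \cup \{0\}$; abelian groups are written additively and $\mathbb{Z}_n$ is the cyclic group of order $n$. For an abelian group $A$, $\mathbb{Z}[A]$ is the integral group ring; its elements are written as finite sums $\sum_{a\in A} z_a \tau_a$ with $z_a \in \mathbb{Z}$, and $\tau_a \cdot \tau_b = \tau_{a+b}$. The augmentation ideal $\operatorname{Aug}(\mathbb{Z}[A])$ is the ideal of $\mathbb{Z}[A]$ generated by $\{\tau_a - 1 \mid a \in A\}$. For an ideal $I$, $I^0 = \mathbb{Z}[A]$ and $I^n$ is the ideal generated by all products $i_1\cdots i_n$ with $i_1,\ldots,i_n \in I$. For an abelian group $B$, the ring $\mathbb{Z}[A]$ acts on the group $B^A$ of all functions $f : A \to B$ by $((\sum_{a} z_a \tau_a) * f)(x) = \sum_{a} z_a f(x+a)$. For an ideal $J$, $J * f = 0$ means $j * f = 0$ for all $j \in J$. Functional degree: for a function $f : A \to B$ between abelian groups and $I := \operatorname{Aug}(\mathbb{Z}[A])$, $\operatorname{Fdeg}(f) := \min\{ n \in \mathbb{N}_0 \mid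 I^{n+1} * f = 0\}$, with $\operatorname{Fdeg}(f) = \infty$ if no such $n$ exists. *)

theory Defs
  imports "HOL-Algebra.Algebra" "HOL-Library.Extended_Nat"
begin

text \<open>
  Abelian groups are HOL-Algebra's commutative groups, hence in multiplicative notation:
  \<open>\<otimes>\<close>, \<open>\<one>\<close> and \<open>[^]\<close> stand for the sum, the zero and the integer multiples.
\<close>

text \<open>
  The integral group ring. Its elements are the finitely supported integer functions on the
  carrier; \<open>frag_of a\<close> is the basis element \<open>\<tau>\<^sub>a\<close>, and the product is the
  bilinear extension of \<open>\<tau>\<^sub>a \<tau>\<^sub>b = \<tau>\<^sub>a\<^sub>+\<^sub>b\<close>.
\<close>
definition group_ring :: "('a, 'm) monoid_scheme \<Rightarrow> ('a \<Rightarrow>\<^sub>0 int) ring" where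
  "group_ring A =
    \<lparr>carrier = {c. Poly_Mapping.keys c \<subseteq> carrier A},
     monoid.mult = (\<lambda>c d. frag_extend (\<lambda>a. frag_extend (\<lambda>b. frag_of (a \<otimes>\<^bsub>A\<^esub> b)) d) c),
     one = frag_of \<one>\<^bsub>A\<^esub>,
     ring.zero = 0,
     ring.add = (+)\<rparr>"

definition augmentation_ideal :: "('a, 'm) monoid_scheme \<Rightarrow> ('a \<Rightarrow>\<^sub>0 int) set" where
  "augmentation_ideal A =
    Idl\<^bsub>group_ring A\<^esub> {frag_of a - frag_of \<one>\<^bsub>A\<^esub> | a. a \<in> carrier A}"

text \<open>For \<open>n = 0\<close> the only product is the empty one, so the power is the whole ring.\<close>
definition ideal_power :: "('a, 'm) ring_scheme \<Rightarrow> 'a set \<Rightarrow> nat \<Rightarrow> 'a set" where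
  "ideal_power R I n =
    Idl\<^bsub>R\<^esub> {foldr (\<otimes>\<^bsub>R\<^esub>) xs \<one>\<^bsub>R\<^esub> | xs. length xs = n \<and> set xs \<subseteq> I}"

text \<open>The action \<open>((\<Sum>\<^sub>a z\<^sub>a \<tau>\<^sub>a) * f)(x) = \<Sum>\<^sub>a z\<^sub>a f(x + a)\<close> in multiplicative notation.\<close>
definition group_ring_act ::
    "('a, 'm) monoid_scheme \<Rightarrow> ('b, 'n) monoid_scheme \<Rightarrow> ('a \<Rightarrow>\<^sub>0 int) \<Rightarrow> ('a \<Rightarrow> 'b) \<Rightarrow> 'a \<Rightarrow> 'b" where
  "group_ring_act A B z f x =
    (\<Otimes>\<^bsub>B\<^esub> a \<in> Poly_Mapping.keys z. f (x \<otimes>\<^bsub>A\<^esub> a) [^]\<^bsub>B\<^esub> Poly_Mapping.lookup z a)"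

definition annihilates ::
    "('a, 'm) monoid_scheme \<Rightarrow> ('b, 'n) monoid_scheme \<Rightarrow> ('a \<Rightarrow>\<^sub>0 int) set \<Rightarrow> ('a \<Rightarrow> 'b) \<Rightarrow> bool" where
  "annihilates A B J f \<longleftrightarrow>
    (\<forall>j \<in> J. \<forall>x \<in> carrier A. group_ring_act A B j f x = \<one>\<^bsub>B\<^esub>)"

text \<open>The infimum of the empty set of extended naturals is \<open>\<infinity>\<close>.\<close>
definition Fdeg :: "('a, 'm) monoid_scheme \<Rightarrow> ('b, 'n) monoid_scheme \<Rightarrow> ('a \<Rightarrow> 'b) \<Rightarrow> enat" where
  "Fdeg A B f =
    Inf {enat n | n.
      annihilates A B (ideal_power (group_ring A) (augmentation_ideal A) (n + 1)) f}"

definition has_exponent :: "('a, 'm) monoid_scheme \<Rightarrow> nat \<Rightarrow> bool" where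
  "has_exponent G n \<longleftrightarrow>
    0 < n \<and> (\<forall>x \<in> carrier G. x [^]\<^bsub>G\<^esub> n = \<one>\<^bsub>G\<^esub>) \<and>
    (\<forall>m. 0 < m \<and> (\<forall>x \<in> carrier G. x [^]\<^bsub>G\<^esub> m = \<one>\<^bsub>G\<^esub>) \<longrightarrow> n \<le> m)"

lemma
  shows carrier_group_ring: "carrier (group_ring A) = {c. Poly_Mapping.keys c \<subseteq> carrier A}"
    and mult_group_ring: "c \<otimes>\<^bsub>group_ring A\<^esub> d =
      frag_extend (\<lambda>a. frag_extend (\<lambda>b. frag_of (a \<otimes>\<^bsub>A\<^esub> b)) d) c"
    and one_group_ring: "\<one>\<^bsub>group_ring A\<^esub> = frag_of \<one>\<^bsub>A\<^esub>"
    and zero_group_ring: "\<zero>\<^bsub>group_ring A\<^esub> = 0"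
    and add_group_ring: "c \<oplus>\<^bsub>group_ring A\<^esub> d = c + d"
  by (simp_all add: group_ring_def)

lemma group_ring_mult_basis:
  "frag_of a \<otimes>\<^bsub>group_ring A\<^esub> frag_of b = frag_of (a \<otimes>\<^bsub>A\<^esub> b)"
  by (simp add: mult_group_ring)

lemma group_ring_mult_zero_left: "0 \<otimes>\<^bsub>group_ring A\<^esub> d = 0"
  by (simp add: mult_group_ring)

lemma group_ring_mult_zero_right: "c \<otimes>\<^bsub>group_ring A\<^esub> 0 = 0"
  by (simp add: mult_group_ring frag_extend_eq_0)

lemma group_ring_mult_diff_left:
  "(c - d) \<otimes>\<^bsub>group_ring A\<^esub> e = c \<otimes>\<^bsub>group_ring A\<^esub> e - d \<otimes>\<^bsub>group_ring A\<^esub> e"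
  by (simp add: mult_group_ring frag_extend_diff)

lemma group_ring_mult_diff_right:
  "c \<otimes>\<^bsub>group_ring A\<^esub> (d - e) = c \<otimes>\<^bsub>group_ring A\<^esub> d - c \<otimes>\<^bsub>group_ring A\<^esub> e"
proof -
  have "Poly_Mapping.keys c \<subseteq> UNIV" by simp
  then show ?thesis
    unfolding mult_group_ring by (induction c rule: frag_induction) (auto simp: frag_extend_diff)
qed

lemmas group_ring_mult_bilinear =
  group_ring_mult_zero_left group_ring_mult_zero_right
  group_ring_mult_diff_left group_ring_mult_diff_right

lemma group_ring_mult_add_left:
  "(c + d) \<otimes>\<^bsub>group_ring A\<^esub> e = c \<otimes>\<^bsub>group_ring A\<^esub> e + d \<otimes>\<^bsub>group_ring A\<^esub> e"
  by (simp add: mult_group_ring frag_extend_add)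

lemma group_ring_mult_keys:
  assumes "comm_group A"
    and "Poly_Mapping.keys c \<subseteq> carrier A" and "Poly_Mapping.keys d \<subseteq> carrier A"
  shows "Poly_Mapping.keys (c \<otimes>\<^bsub>group_ring A\<^esub> d) \<subseteq> carrier A"
proof -
  interpret comm_group A by fact
  have "Poly_Mapping.keys (frag_extend (\<lambda>b. frag_of (a \<otimes>\<^bsub>A\<^esub> b)) d) \<subseteq> carrier A"
    if "a \<in> carrier A" for a
    using keys_frag_extend[of "\<lambda>b. frag_of (a \<otimes>\<^bsub>A\<^esub> b)" d] assms(3) that by fastforce
  then show ?thesis
    unfolding mult_group_ring
    using keys_frag_extend[of "\<lambda>a. frag_extend (\<lambda>b. frag_of (a \<otimes>\<^bsub>A\<^esub> b)) d" c] assms(2) by blast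
qed

lemma group_ring_mult_comm:
  assumes "comm_group A"
    and "Poly_Mapping.keys c \<subseteq> carrier A" and "Poly_Mapping.keys d \<subseteq> carrier A"
  shows "c \<otimes>\<^bsub>group_ring A\<^esub> d = d \<otimes>\<^bsub>group_ring A\<^esub> c"
proof -
  interpret comm_group A by fact
  have basis: "frag_of a \<otimes>\<^bsub>group_ring A\<^esub> d = d \<otimes>\<^bsub>group_ring A\<^esub> frag_of a"
    if "a \<in> carrier A" for a
    using assms(3)
    by (induction d rule: frag_induction)
      (use that in \<open>simp_all add: group_ring_mult_bilinear group_ring_mult_basis m_comm\<close>)
  show ?thesis
    using assms(2)
    by (induction c rule: frag_induction) (simp_all add: group_ring_mult_bilinear basis)
qed

lemma group_ring_mult_assoc:
  assumes "comm_group A"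
    and "Poly_Mapping.keys c \<subseteq> carrier A" and "Poly_Mapping.keys d \<subseteq> carrier A"
    and "Poly_Mapping.keys e \<subseteq> carrier A"
  shows "(c \<otimes>\<^bsub>group_ring A\<^esub> d) \<otimes>\<^bsub>group_ring A\<^esub> e =
    c \<otimes>\<^bsub>group_ring A\<^esub> (d \<otimes>\<^bsub>group_ring A\<^esub> e)"
proof -
  interpret comm_group A by fact
  have basis2: "(frag_of a \<otimes>\<^bsub>group_ring A\<^esub> frag_of b) \<otimes>\<^bsub>group_ring A\<^esub> e =
      frag_of a \<otimes>\<^bsub>group_ring A\<^esub> (frag_of b \<otimes>\<^bsub>group_ring A\<^esub> e)"
    if "a \<in> carrier A" "b \<in> carrier A" for a b
    using assms(4)
    by (induction e rule: frag_induction)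
      (use that in \<open>simp_all add: group_ring_mult_bilinear group_ring_mult_basis m_assoc\<close>)
  have basis: "(frag_of a \<otimes>\<^bsub>group_ring A\<^esub> d) \<otimes>\<^bsub>group_ring A\<^esub> e =
      frag_of a \<otimes>\<^bsub>group_ring A\<^esub> (d \<otimes>\<^bsub>group_ring A\<^esub> e)"
    if "a \<in> carrier A" for a
    using assms(3)
    by (induction d rule: frag_induction)
      (use that in \<open>simp_all add: group_ring_mult_bilinear basis2\<close>)
  show ?thesis
    using assms(2)
    by (induction c rule: frag_induction) (simp_all add: group_ring_mult_bilinear basis)
qed

lemma group_ring_mult_one:
  assumes "comm_group A" and "Poly_Mapping.keys c \<subseteq> carrier A"
  shows "\<one>\<^bsub>group_ring A\<^esub> \<otimes>\<^bsub>group_ring A\<^esub> c = c"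
proof -
  interpret comm_group A by fact
  show ?thesis
    using assms(2)
    by (induction c rule: frag_induction)
      (simp_all add: one_group_ring group_ring_mult_bilinear group_ring_mult_basis)
qed

text \<open>In particular \<open>Idl\<close> is meaningful here: over a structure that is not a ring there are no
  ideals at all, and \<open>Idl\<close> would be the universal set.\<close>
lemma cring_group_ring:
  assumes "comm_group A"
  shows "cring (group_ring A)"
proof (rule cringI)
  interpret comm_group A by fact
  show "abelian_group (group_ring A)"
  proof (rule abelian_groupI)
    fix c assume "c \<in> carrier (group_ring A)"
    then have "- c \<in> carrier (group_ring A) \<and> - c \<oplus>\<^bsub>group_ring A\<^esub> c = \<zero>\<^bsub>group_ring A\<^esub>"
      by (simp add: carrier_group_ring add_group_ring zero_group_ring)
    then show "\<exists>d \<in> carrier (group_ring A). d \<oplus>\<^bsub>group_ring A\<^esub> c = \<zero>\<^bsub>group_ring A\<^esub>"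
      by blast
  next
    fix c d assume "c \<in> carrier (group_ring A)" "d \<in> carrier (group_ring A)"
    then show "c \<oplus>\<^bsub>group_ring A\<^esub> d \<in> carrier (group_ring A)"
      using keys_add[of c d] by (auto simp: carrier_group_ring add_group_ring)
  qed (auto simp: carrier_group_ring add_group_ring zero_group_ring algebra_simps)
  show "comm_monoid (group_ring A)"
  proof (rule comm_monoidI)
    show "\<one>\<^bsub>group_ring A\<^esub> \<in> carrier (group_ring A)"
      by (simp add: carrier_group_ring one_group_ring)
    fix c d assume "c \<in> carrier (group_ring A)" "d \<in> carrier (group_ring A)"
    then show "c \<otimes>\<^bsub>group_ring A\<^esub> d = d \<otimes>\<^bsub>group_ring A\<^esub> c"
      using group_ring_mult_comm[OF assms] by (simp add: carrier_group_ring)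
  qed (simp_all add: carrier_group_ring assms group_ring_mult_keys group_ring_mult_assoc
      group_ring_mult_one)
qed (simp add: add_group_ring group_ring_mult_add_left)

end

theory Submission
  imports Defs
begin

text \<open>
  Let \<open>I\<close> be the augmentation ideal, \<open>q\<^sub>i = p ^ \<alpha> i\<close>, \<open>M = \<Sum>\<^sub>i (q\<^sub>i - 1)\<close>, and let \<open>x\<^sub>i = \<tau> - 1\<close> for \<open>\<tau>\<close> the
  \<open>i\<close>-th standard generator; the \<open>x\<^sub>i\<close> generate \<open>I\<close>. Since \<open>(1 + x\<^sub>i)\<close> has \<open>q\<^sub>i\<close>-th power \<open>1\<close> and \<open>p\<close>
  divides the inner binomial coefficients of \<open>q\<^sub>i\<close>, the \<open>q\<^sub>i\<close>-th power of \<open>x\<^sub>i\<close> lies in \<open>p I\<close>. By the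
  pigeonhole principle every monomial of degree \<open>M + 1\<close> in the \<open>x\<^sub>i\<close> lies in \<open>p I\<close>. It is essential
  to land in \<open>p I\<close> and not merely in the multiples of \<open>p\<close>: the retained factor from \<open>I\<close>
  joins the next \<open>M\<close> factors, so that degree \<open>\<beta> M + 1\<close>, rather than \<open>\<beta> (M + 1)\<close>, suffices to
  reach \<open>p ^ \<beta> I\<close>, which kills every function into \<open>B\<close>.
\<close>

section \<open>Ideals of multiples, colon ideals and products of generated ideals\<close>

text \<open>The multiples are those of elements of \<open>I\<close>, not of the whole ring. Being an
  ideal, \<open>n I\<close> can later serve as the target of arguments that check generators
  only.\<close>

lemma (in cring) add_pow_image_ideal:
  assumes "ideal I R"
  shows "ideal (add_pow R (n::nat) ` I) R"
proof (rule idealI[OF ring_axioms])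
  interpret I: ideal I R by fact
  have I: "I \<subseteq> carrier R" using I.Icarr by blast
  show "subgroup (add_pow R n ` I) (add_monoid R)"
  proof (rule add.subgroupI)
    fix a assume "a \<in> add_pow R n ` I"
    then obtain y where y: "y \<in> I" "a = add_pow R n y" by blast
    then have "\<ominus> a = add_pow R n (\<ominus> y)"
      using I.Icarr by (simp add: add.nat_pow_inv)
    then show "\<ominus> a \<in> add_pow R n ` I" using y by blast
    fix b assume "b \<in> add_pow R n ` I"
    then obtain z where z: "z \<in> I" "b = add_pow R n z" by blast
    then have "a \<oplus> b = add_pow R n (y \<oplus> z)"
      using I.Icarr y by (simp add: add.nat_pow_distrib)
    then show "a \<oplus> b \<in> add_pow R n ` I" using y z by blast
  next
    show "add_pow R n ` I \<noteq> {}" using additive_subgroup.zero_closed[OF I.additive_subgroup_axioms] by blast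
  qed (use I in auto)
next
  interpret I: ideal I R by fact
  fix a x assume a: "a \<in> add_pow R n ` I" and x: "x \<in> carrier R"
  then show "x \<otimes> a \<in> add_pow R n ` I"
    using add_pow_rdistr I.I_l_closed I.Icarr by (auto intro!: image_eqI)
  show "a \<otimes> x \<in> add_pow R n ` I"
    using a x add_pow_ldistr I.I_r_closed I.Icarr by (auto intro!: image_eqI)
qed

text \<open>This is the colon ideal \<open>(J : x)\<close>. Through \<open>genideal_minimal\<close>
  it extends a statement \<open>x \<otimes> y \<in> J\<close> from generators \<open>y\<close> to
  all elements of the ideal that they generate.\<close>

lemma (in cring) ideal_colon:
  assumes "ideal J R" and x: "x \<in> carrier R"
  shows "ideal {y \<in> carrier R. x \<otimes> y \<in> J} R"
proof (rule idealI[OF ring_axioms])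
  interpret J: ideal J R by fact
  show "subgroup {y \<in> carrier R. x \<otimes> y \<in> J} (add_monoid R)"
    by (rule add.subgroupI) (use x in \<open>auto simp: r_distr r_minus intro!: exI[of _ \<zero>]\<close>)
next
  interpret J: ideal J R by fact
  fix a y assume a: "a \<in> {y \<in> carrier R. x \<otimes> y \<in> J}" and y: "y \<in> carrier R"
  then have "x \<otimes> (a \<otimes> y) \<in> J"
    using J.I_r_closed[of "x \<otimes> a" y] x by (simp add: m_assoc)
  then show "a \<otimes> y \<in> {y \<in> carrier R. x \<otimes> y \<in> J}" "y \<otimes> a \<in> {y \<in> carrier R. x \<otimes> y \<in> J}"
    using a y by (auto simp: m_comm)
qed

text \<open>The colon argument is applied twice. For \<open>s \<in> S\<close> the ideal
  \<open>(J : s)\<close> contains \<open>T\<close>, hence \<open>Idl T\<close>; then for the given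
  \<open>y \<in> Idl T\<close> the ideal \<open>(J : y)\<close> contains \<open>S\<close>, hence
  \<open>Idl S\<close>.\<close>

lemma (in cring) genideal_mult_closed:
  assumes "ideal J R" "S \<subseteq> carrier R" "T \<subseteq> carrier R"
    and "\<And>s t. s \<in> S \<Longrightarrow> t \<in> T \<Longrightarrow> s \<otimes> t \<in> J"
    and "x \<in> Idl S" "y \<in> Idl T"
  shows "x \<otimes> y \<in> J"
proof -
  have *: "Idl T \<subseteq> {y \<in> carrier R. s \<otimes> y \<in> J}" if "s \<in> S" for s
  proof (rule genideal_minimal)
    show "ideal {y \<in> carrier R. s \<otimes> y \<in> J} R"
      using that assms(2) by (intro ideal_colon[OF assms(1)]) blast
    show "T \<subseteq> {y \<in> carrier R. s \<otimes> y \<in> J}"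
      using that assms(3,4) by blast
  qed
  have y: "y \<in> carrier R"
    using ideal.Icarr[OF genideal_ideal[OF assms(3)] assms(6)] .
  have "y \<otimes> s \<in> J" if "s \<in> S" for s
  proof -
    have "s \<otimes> y \<in> J" using *[OF that] assms(6) by blast
    moreover have "s \<in> carrier R" using that assms(2) by blast
    ultimately show ?thesis using m_comm[OF y] by simp
  qed
  then have "S \<subseteq> {x \<in> carrier R. y \<otimes> x \<in> J}"
    using assms(2) by blast
  then have "Idl S \<subseteq> {x \<in> carrier R. y \<otimes> x \<in> J}"
    by (rule genideal_minimal[OF ideal_colon[OF assms(1) y]])
  then have "y \<otimes> x \<in> J" "x \<in> carrier R" using assms(5) by auto
  then show ?thesis using m_comm[OF y] by simp
qed

section \<open>Monomials in the generators and the pigeonhole argument\<close>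

lemma (in cring) finprod_pow_fun_upd_Suc:
  assumes "finite K" "x \<in> K \<rightarrow> carrier R" "i \<in> K"
  shows "(\<Otimes>j\<in>K. x j [^] ((e(i := Suc (e i))) j :: nat)) = x i \<otimes> (\<Otimes>j\<in>K. x j [^] e j)"
proof -
  have x: "x i \<in> carrier R" "\<And>j. j \<in> K \<Longrightarrow> x j \<in> carrier R" using assms by auto
  obtain L where L: "K = insert i L" "i \<notin> L" using assms by (metis mk_disjoint_insert)
  have fin: "finite L" using assms L by simp
  have eq: "(\<Otimes>j\<in>L. x j [^] ((e(i := Suc (e i))) j)) = (\<Otimes>j\<in>L. x j [^] e j)"
    using L x by (intro finprod_cong') auto
  have ins: "(\<Otimes>j\<in>K. x j [^] h j) = x i [^] h i \<otimes> (\<Otimes>j\<in>L. x j [^] h j)" for h :: "'c \<Rightarrow> nat"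
    unfolding L(1) using fin L x by (intro finprod_insert) auto
  have "(\<Otimes>j\<in>L. x j [^] e j) \<in> carrier R"
    using L(1) x by (intro finprod_closed) auto
  moreover have "x i [^] Suc (e i) = x i \<otimes> x i [^] e i"
    using x(1) by (simp add: m_comm)
  ultimately show ?thesis
    unfolding ins eq using x(1) by (simp add: m_assoc)
qed

lemma (in cring) prod_in_monomial_ideal:
  assumes "finite K" and x: "x \<in> K \<rightarrow> carrier R"
  shows "set zs \<subseteq> Idl (x ` K) \<Longrightarrow> foldr (\<otimes>) zs \<one> \<in>
    Idl {\<Otimes>i\<in>K. x i [^] e i | e :: 'c \<Rightarrow> nat. sum e K = length zs}"
proof (induction zs)
  case Nil
  have "\<one> = (\<Otimes>i\<in>K. x i [^] (0::nat))"
    using x by (simp add: finprod_one_eqI)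
  then have "\<one> \<in> {\<Otimes>i\<in>K. x i [^] e i | e :: 'c \<Rightarrow> nat. sum e K = 0}"
    by (auto intro!: exI[of _ "\<lambda>_. 0"])
  then show ?case
    using x by (auto intro!: subsetD[OF genideal_self] finprod_closed)
next
  case (Cons z zs)
  let ?M = "\<lambda>n. {\<Otimes>i\<in>K. x i [^] e i | e :: 'c \<Rightarrow> nat. sum e K = n}"
  have M: "?M n \<subseteq> carrier R" for n
    using x by (auto intro!: finprod_closed)
  have "z \<otimes> foldr (\<otimes>) zs \<one> \<in> Idl (?M (Suc (length zs)))"
  proof (rule genideal_mult_closed[where S = "x ` K" and T = "?M (length zs)"])
    fix s t assume "s \<in> x ` K" "t \<in> ?M (length zs)"
    then obtain i e where *: "i \<in> K" "s = x i" "t = (\<Otimes>i\<in>K. x i [^] e i)" "sum e K = length zs"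
      by auto
    have "sum (e(i := Suc (e i))) (K - {i}) = sum e (K - {i})"
      by (intro sum.cong) auto
    then have "sum (e(i := Suc (e i))) K = Suc (sum e K)"
      using sum.remove[OF assms(1) *(1), of e] sum.remove[OF assms(1) *(1), of "e(i := Suc (e i))"]
      by simp
    moreover have "s \<otimes> t = (\<Otimes>j\<in>K. x j [^] ((e(i := Suc (e i))) j))"
      using finprod_pow_fun_upd_Suc[OF assms *(1)] * by simp
    ultimately have "s \<otimes> t \<in> ?M (Suc (length zs))"
      unfolding *(4) by blast
    then show "s \<otimes> t \<in> Idl (?M (Suc (length zs)))"
      using genideal_self[OF M] by blast
  next
    show "z \<in> Idl (x ` K)" "foldr (\<otimes>) zs \<one> \<in> Idl (?M (length zs))"
      using Cons by simp_all
  next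
    show "x ` K \<subseteq> carrier R" using x by blast
  qed (rule genideal_ideal M)+
  then show ?case by simp
qed

text \<open>A monomial with all exponents at most \<open>d i - 1\<close> has degree at most the sum
  of these bounds. In any higher degree some exponent reaches \<open>d i\<close>, and
  \<open>J\<close> absorbs the remaining factors.\<close>

lemma (in cring) prod_in_ideal_pigeonhole:
  assumes "finite K" and x: "x \<in> K \<rightarrow> carrier R" and "ideal J R"
    and J: "\<And>i. i \<in> K \<Longrightarrow> x i [^] (d i :: nat) \<in> J"
    and zs: "set zs \<subseteq> Idl (x ` K)" "length zs > (\<Sum>i\<in>K. d i - 1)"
  shows "foldr (\<otimes>) zs \<one> \<in> J"
proof -
  interpret J: ideal J R by fact
  have "(\<Otimes>i\<in>K. x i [^] e i) \<in> J" if e: "sum e K = length zs" for e :: "'c \<Rightarrow> nat"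
  proof -
    have "\<exists>i\<in>K. e i > d i - 1"
    proof (rule ccontr)
      assume "\<not> (\<exists>i\<in>K. e i > d i - 1)"
      then have "sum e K \<le> (\<Sum>i\<in>K. d i - 1)" by (intro sum_mono) (simp add: not_less)
      then show False using zs(2) e by simp
    qed
    \<comment> \<open>Truncated subtraction does no harm: for \<open>d i = 0\<close> the bound
      \<open>d i \<le> e i\<close> is trivial.\<close>
    then obtain i where i: "i \<in> K" "d i \<le> e i" by fastforce
    have xi: "x i \<in> carrier R" using i x by blast
    have "x i [^] e i = x i [^] d i \<otimes> x i [^] (e i - d i)"
      using i xi by (simp add: nat_pow_mult)
    then have *: "x i [^] e i \<in> J"
      using J[OF i(1)] xi J.I_r_closed by simp
    have "(\<Otimes>i\<in>K. x i [^] e i) = x i [^] e i \<otimes> (\<Otimes>j\<in>K - {i}. x j [^] e j)"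
    proof -
      have "K = insert i (K - {i})" using i by blast
      then have "(\<Otimes>i\<in>K. x i [^] e i) = (\<Otimes>i\<in>insert i (K - {i}). x i [^] e i)" by simp
      also have "\<dots> = x i [^] e i \<otimes> (\<Otimes>j\<in>K - {i}. x j [^] e j)"
        using assms(1) x i by (intro finprod_insert) auto
      finally show ?thesis .
    qed
    moreover have "(\<Otimes>j\<in>K - {i}. x j [^] e j) \<in> carrier R"
      using x by (intro finprod_closed) auto
    ultimately show ?thesis using * J.I_r_closed by simp
  qed
  then have "Idl {\<Otimes>i\<in>K. x i [^] e i | e :: 'c \<Rightarrow> nat. sum e K = length zs} \<subseteq> J"
    by (intro genideal_minimal assms) blast
  then show ?thesis using prod_in_monomial_ideal[OF assms(1) x zs(1)] by blast
qed

section \<open>Iterating the gain of one factor \<open>p\<close>\<close>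

lemma (in monoid) foldr_mult_closed:
  "set zs \<subseteq> carrier G \<Longrightarrow> foldr (\<otimes>) zs \<one> \<in> carrier G"
  by (induction zs) auto

lemma (in monoid) foldr_mult_append:
  "set zs \<subseteq> carrier G \<Longrightarrow> set ws \<subseteq> carrier G \<Longrightarrow>
    foldr (\<otimes>) (zs @ ws) \<one> = foldr (\<otimes>) zs \<one> \<otimes> foldr (\<otimes>) ws \<one>"
  by (induction zs) (simp_all add: m_assoc foldr_mult_closed)

text \<open>Each round uses only \<open>M\<close> new factors. The last \<open>Suc (j * M)\<close>
  factors multiply to \<open>p ^ j\<close> times some \<open>y \<in> I\<close>, and \<open>y\<close>
  completes the first \<open>M\<close> factors to the \<open>Suc M\<close> elements of
  \<open>I\<close> that \<open>base\<close> requires.\<close>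

lemma (in cring) prod_in_add_pow_image_iterate:
  assumes "ideal I R"
    and base: "\<And>zs. set zs \<subseteq> I \<Longrightarrow> length zs = Suc M \<Longrightarrow> foldr (\<otimes>) zs \<one> \<in> add_pow R (p::nat) ` I"
  shows "set zs \<subseteq> I \<Longrightarrow> length zs = Suc (j * M) \<Longrightarrow>
    foldr (\<otimes>) zs \<one> \<in> add_pow R (p ^ j) ` I"
proof (induction j arbitrary: zs)
  case 0
  interpret I: ideal I R by fact
  \<comment> \<open>A single factor starts the induction, since the multiples by
    \<open>p ^ 0\<close> of \<open>I\<close> are \<open>I\<close> itself. This is the extra one in
    the length \<open>Suc (j * M)\<close>.\<close>
  from 0 obtain z where "zs = [z]" "z \<in> I" by (auto simp: length_Suc_conv)
  then show ?case using I.Icarr by simp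
next
  case (Suc j)
  interpret I: ideal I R by fact
  have I: "I \<subseteq> carrier R" using I.Icarr by blast
  define us vs where uv: "us = take M zs" "vs = drop M zs"
  have zs: "zs = us @ vs" by (simp add: uv)
  have sub: "set us \<subseteq> I" "set vs \<subseteq> I" using Suc.prems zs by auto
  have len: "length us = M" "length vs = Suc (j * M)" using Suc.prems by (auto simp: uv)
  obtain y where y: "y \<in> I" "foldr (\<otimes>) vs \<one> = add_pow R (p ^ j) y"
    using Suc.IH[OF sub(2) len(2)] by blast
  obtain w where w: "w \<in> I" "foldr (\<otimes>) (us @ [y]) \<one> = add_pow R p w"
    using base[of "us @ [y]"] sub len y by auto
  have cl: "foldr (\<otimes>) us \<one> \<in> carrier R"
    using foldr_mult_closed sub I by blast
  have "foldr (\<otimes>) zs \<one> = foldr (\<otimes>) us \<one> \<otimes> add_pow R (p ^ j) y"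
    unfolding zs using y sub I by (subst foldr_mult_append) auto
  also have "\<dots> = add_pow R (p ^ j) (foldr (\<otimes>) us \<one> \<otimes> y)"
    using cl y I.Icarr by (intro add_pow_rdistr) auto
  also have "foldr (\<otimes>) us \<one> \<otimes> y = add_pow R p w"
    using w(2) sub I y by (subst (asm) foldr_mult_append) auto
  also have "add_pow R (p ^ j) (add_pow R p w) = add_pow R (p ^ Suc j) w"
    using w I.Icarr by (simp add: add.nat_pow_pow)
  finally show ?case using w by blast
qed

section \<open>Binomial expansion at a prime power\<close>

text \<open>The product of \<open>j\<close> and \<open>p ^ a choose j\<close> is a multiple of
  \<open>p ^ a\<close>. If \<open>p\<close> did not divide the coefficient, \<open>p ^ a\<close>
  would divide \<open>j\<close>, which is positive and smaller.\<close>

lemma prime_dvd_prime_power_choose: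
  fixes p :: nat
  assumes "Factorial_Ring.prime p" "0 < j" "j < p ^ a"
  shows "p dvd (p ^ a choose j)"
proof (rule ccontr)
  assume "\<not> p dvd (p ^ a choose j)"
  then have "coprime (p ^ a) (p ^ a choose j)"
    using assms(1) by (simp add: prime_imp_coprime)
  moreover have "p ^ a dvd j * (p ^ a choose j)"
    using times_binomial_minus1_eq[OF assms(2), of "p ^ a"] by simp
  ultimately have "p ^ a dvd j"
    by (simp add: coprime_dvd_mult_left_iff)
  then have "p ^ a \<le> j" using assms(2) by (rule dvd_imp_le)
  then show False using assms(3) by simp
qed

text \<open>Induction on \<open>n\<close> by Pascal's rule. Integer coefficients are expressed by
  \<open>add_pow\<close>, so that their divisibility by \<open>p\<close> can be used in an arbitrary
  commutative ring.\<close>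

lemma (in cring) binomial_one:
  assumes x: "x \<in> carrier R"
  shows "(x \<oplus> \<one>) [^] (n::nat) = (\<Oplus>i\<in>{..n}. add_pow R (n choose i) (x [^] i))"
proof (induction n)
  case 0
  then show ?case using x by simp
next
  case (Suc n)
  let ?t = "\<lambda>m i. add_pow R (m::nat) (x [^] (i::nat))"
  have cl: "?t m i \<in> carrier R" for m i using x by simp
  have "(x \<oplus> \<one>) [^] Suc n = (\<Oplus>i\<in>{..n}. ?t (n choose i) i) \<otimes> (x \<oplus> \<one>)"
    using Suc by simp
  also have "\<dots> = (\<Oplus>i\<in>{..n}. ?t (n choose i) i) \<otimes> x \<oplus> (\<Oplus>i\<in>{..n}. ?t (n choose i) i)"
    using x by (subst r_distr) (auto intro!: finsum_closed)
  also have "(\<Oplus>i\<in>{..n}. ?t (n choose i) i) \<otimes> x = (\<Oplus>i\<in>{..n}. ?t (n choose i) (Suc i))"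
    using x by (subst finsum_ldistr) (auto simp: add_pow_ldistr)
  \<comment> \<open>The added summand vanishes because \<open>n choose Suc n\<close> is zero.
    Splitting off index 0 then leaves a sum over the same range as the shifted one.\<close>
  also have "(\<Oplus>i\<in>{..n}. ?t (n choose i) i) = (\<Oplus>i\<in>{..Suc n}. ?t (n choose i) i)"
    using cl by (subst finsum_Suc) (auto simp: binomial_eq_0 intro!: finsum_closed)
  also have "\<dots> = (\<Oplus>i\<in>{..n}. ?t (n choose Suc i) (Suc i)) \<oplus> ?t 1 0"
    using x by (subst finsum_Suc2) (auto simp: cl)
  also have "(\<Oplus>i\<in>{..n}. ?t (n choose i) (Suc i)) \<oplus> \<dots> =
      (\<Oplus>i\<in>{..n}. ?t (n choose i) (Suc i)) \<oplus> (\<Oplus>i\<in>{..n}. ?t (n choose Suc i) (Suc i)) \<oplus> ?t 1 0"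
    using x by (subst a_assoc) (auto intro!: finsum_closed)
  also have "(\<Oplus>i\<in>{..n}. ?t (n choose i) (Suc i)) \<oplus> (\<Oplus>i\<in>{..n}. ?t (n choose Suc i) (Suc i)) =
      (\<Oplus>i\<in>{..n}. ?t (n choose i) (Suc i) \<oplus> ?t (n choose Suc i) (Suc i))"
    using x by (subst finsum_addf) auto
  also have "\<dots> = (\<Oplus>i\<in>{..n}. ?t (Suc n choose Suc i) (Suc i))"
    using x by (intro finsum_cong') (auto simp: add.nat_pow_mult)
  also have "\<dots> \<oplus> ?t 1 0 = (\<Oplus>i\<in>{..Suc n}. ?t (Suc n choose i) i)"
    using x by (subst finsum_Suc2) (auto simp: cl)
  finally show ?case .
qed

lemma (in ideal) finsum_mem:
  assumes "\<And>i. i \<in> S \<Longrightarrow> g i \<in> I"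
  shows "finsum R g S \<in> I"
proof -
  have "finite S \<Longrightarrow> (\<And>i. i \<in> S \<Longrightarrow> g i \<in> I) \<Longrightarrow> finsum R g S \<in> I"
    by (induction S rule: finite_induct) (auto simp: Pi_def Icarr)
  \<comment> \<open>For infinite \<open>S\<close> the sum has the default value
    \<open>\<zero>\<close>, which lies in \<open>I\<close>.\<close>
  then show ?thesis using assms by (cases "finite S") auto
qed

text \<open>In the expansion of \<open>(x \<oplus> \<one>) [^] (p ^ a) = \<one>\<close> the constant
  terms cancel, so the top power of \<open>x\<close> is minus the sum of the inner terms. Each of
  these is \<open>p\<close> times a multiple of a positive power of \<open>x\<close>, and that
  multiple is still in \<open>I\<close>.\<close>

lemma (in cring) pow_prime_power_in_add_pow_image:
  fixes p a :: nat
  assumes p: "Factorial_Ring.prime p" and "ideal I R" and x: "x \<in> I"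
    and unity: "(x \<oplus> \<one>) [^] (p ^ a) = \<one>"
  shows "x [^] (p ^ a) \<in> add_pow R p ` I"
proof -
  interpret I: ideal I R by fact
  interpret J: ideal "add_pow R p ` I" R by (rule add_pow_image_ideal) fact
  have xc: "x \<in> carrier R" using x I.Icarr by blast
  obtain m where m: "p ^ a = Suc m" using p by (metis not0_implies_Suc power_not_zero not_prime_0)
  let ?g = "\<lambda>i. add_pow R (p ^ a choose Suc i) (x [^] Suc i)"
  have mem: "?g i \<in> add_pow R p ` I" if "i < m" for i
  proof -
    have "p dvd (p ^ a choose Suc i)"
      by (rule prime_dvd_prime_power_choose[OF p]) (use that m in auto)
    then obtain c where c: "(p ^ a choose Suc i) = p * c" by (rule dvdE)
    have "x [^] Suc i \<in> I" using x xc I.I_l_closed by simp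
    then have "add_pow R c (x [^] Suc i) \<in> I"
      by (induction c) (use I.Icarr in auto)
    moreover have "?g i = add_pow R p (add_pow R c (x [^] Suc i))"
      using xc unfolding c by (simp add: add.nat_pow_pow mult.commute)
    ultimately show ?thesis by blast
  qed
  \<comment> \<open>The inner terms have degrees 1 to \<open>m\<close>, where
    \<open>Suc m = p ^ a\<close>. For \<open>a = 0\<close> there are none, and \<open>unity\<close>
    says that \<open>x\<close> is zero.\<close>
  define s where "s = (\<Oplus>i\<in>{..<m}. ?g i)"
  have sJ: "s \<in> add_pow R p ` I" unfolding s_def by (rule J.finsum_mem) (use mem in auto)
  have "\<one> = (\<Oplus>i\<in>{..Suc m}. add_pow R (p ^ a choose i) (x [^] i))"
    using binomial_one[OF xc, of "p ^ a"] unity m by simp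
  also have "\<dots> = (\<Oplus>i\<in>{..m}. ?g i) \<oplus> \<one>"
    using xc by (subst finsum_Suc2) auto
  also have "(\<Oplus>i\<in>{..m}. ?g i) = x [^] (p ^ a) \<oplus> s"
  proof -
    have "{..m} = insert m {..<m}" by auto
    then have "(\<Oplus>i\<in>{..m}. ?g i) = (\<Oplus>i\<in>insert m {..<m}. ?g i)" by simp
    also have "\<dots> = ?g m \<oplus> s" unfolding s_def using xc by (intro finsum_insert) auto
    finally show ?thesis using m xc by simp
  qed
  finally have "x [^] (p ^ a) \<oplus> s = \<zero>"
    using xc J.Icarr[OF sJ] by (metis add.l_cancel_one add.m_closed nat_pow_closed one_closed a_comm)
  then have "x [^] (p ^ a) = \<ominus> s"
    using xc J.Icarr[OF sJ] by (metis minus_equality nat_pow_closed)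
  then show ?thesis using sJ by simp
qed

section \<open>The group ring, generators of the augmentation ideal, and the action\<close>

text \<open>Turns multiples in the abstract ring into coefficientwise multiples, the form in which
  \<open>group_ring_act\<close> can be evaluated.\<close>

lemma add_pow_group_ring:
  assumes "comm_group A"
  shows "add_pow (group_ring A) (n::nat) c = frag_cmul (int n) c"
proof -
  interpret R: cring "group_ring A" by (rule cring_group_ring) fact
  show ?thesis
    by (induction n) (simp_all add: zero_group_ring add_group_ring frag_cmul_distrib)
qed

lemma pow_group_ring_basis:
  assumes "comm_group A" "a \<in> carrier A"
  shows "frag_of a [^]\<^bsub>group_ring A\<^esub> (n::nat) = frag_of (a [^]\<^bsub>A\<^esub> n)"
proof -
  interpret A: comm_group A by fact
  interpret R: cring "group_ring A" by (rule cring_group_ring) fact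
  show ?thesis
    by (induction n) (simp_all add: one_group_ring group_ring_mult_basis)
qed

lemma augmentation_generator_carrier:
  assumes "comm_group A" "a \<in> carrier A"
  shows "frag_of a - frag_of \<one>\<^bsub>A\<^esub> \<in> carrier (group_ring A)"
proof -
  interpret A: comm_group A by fact
  show ?thesis
    using assms(2) keys_diff[of "frag_of a" "frag_of \<one>\<^bsub>A\<^esub>"]
    by (auto simp: carrier_group_ring split: if_splits)
qed

lemma augmentation_ideal_ideal:
  assumes "comm_group A"
  shows "ideal (augmentation_ideal A) (group_ring A)"
proof -
  interpret R: cring "group_ring A" by (rule cring_group_ring) fact
  show ?thesis
    unfolding augmentation_ideal_def
    by (rule R.genideal_ideal) (use augmentation_generator_carrier[OF assms] in blast)
qed

text \<open>Induction over \<open>generate\<close>, with \<open>?x a\<close> standing for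
  \<open>\<tau>\<^sub>a - 1\<close>. For a product,
  \<open>?x (g h) = \<tau>\<^sub>g ?x h + ?x g\<close>; for an inverse, \<open>?x (inv s)\<close> is
  minus the product of \<open>?x s\<close> and the basis element of \<open>inv s\<close>.\<close>

lemma augmentation_ideal_eq_genideal:
  assumes "comm_group A" and S: "S \<subseteq> carrier A" "generate A S = carrier A"
  shows "augmentation_ideal A =
    Idl\<^bsub>group_ring A\<^esub> ((\<lambda>s. frag_of s - frag_of \<one>\<^bsub>A\<^esub>) ` S)" (is "_ = ?J")
proof -
  interpret A: comm_group A by fact
  interpret R: cring "group_ring A" by (rule cring_group_ring) fact
  let ?x = "\<lambda>s. frag_of s - frag_of \<one>\<^bsub>A\<^esub>"
  note xc = augmentation_generator_carrier[OF assms(1)]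
  have Sc: "?x ` S \<subseteq> carrier (group_ring A)" using S xc by blast
  interpret J: ideal ?J "group_ring A" by (rule R.genideal_ideal) fact
  have tau: "frag_of a \<in> carrier (group_ring A)" if "a \<in> carrier A" for a
    using that by (simp add: carrier_group_ring)
  have mem: "?x s \<in> ?J" if "s \<in> S" for s
    using R.genideal_self[OF Sc] that by blast
  have "a \<in> carrier A \<and> ?x a \<in> ?J" if "a \<in> generate A S" for a
    using that
  proof induction
    case one
    have "0 \<in> ?J" using J.additive_subgroup_axioms additive_subgroup.zero_closed zero_group_ring by metis
    then show ?case by simp
  next
    case (incl s)
    then show ?case using mem S by blast
  next
    case (inv s)
    have s: "s \<in> carrier A" using inv S by blast
    have "?x s \<otimes>\<^bsub>group_ring A\<^esub> frag_of (inv\<^bsub>A\<^esub> s) \<in> ?J"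
      using J.I_r_closed mem[OF inv] tau s by blast
    then have y: "frag_of \<one>\<^bsub>A\<^esub> - frag_of (inv\<^bsub>A\<^esub> s) \<in> ?J"
      using s by (simp add: group_ring_mult_diff_left group_ring_mult_basis)
    have "\<ominus>\<^bsub>group_ring A\<^esub> (frag_of \<one>\<^bsub>A\<^esub> - frag_of (inv\<^bsub>A\<^esub> s)) = ?x (inv\<^bsub>A\<^esub> s)"
      by (rule R.minus_equality)
        (use s xc y J.Icarr in \<open>simp_all add: add_group_ring zero_group_ring\<close>)
    then show ?case using J.a_inv_closed[OF y] s by simp
  next
    case (eng g h)
    have "frag_of g \<otimes>\<^bsub>group_ring A\<^esub> ?x h \<in> ?J"
      using J.I_l_closed eng.IH tau by blast
    then have "frag_of (g \<otimes>\<^bsub>A\<^esub> h) - frag_of g \<in> ?J"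
      using eng.IH by (simp add: group_ring_mult_diff_right group_ring_mult_basis)
    then have "(frag_of (g \<otimes>\<^bsub>A\<^esub> h) - frag_of g) \<oplus>\<^bsub>group_ring A\<^esub> ?x g \<in> ?J"
      using J.a_closed eng.IH by blast
    then show ?case using eng.IH by (simp add: add_group_ring)
  qed
  then have "augmentation_ideal A \<subseteq> ?J"
    unfolding augmentation_ideal_def
    by (intro R.genideal_minimal) (use S J.is_ideal in auto)
  moreover have "?J \<subseteq> augmentation_ideal A"
  proof (rule R.genideal_minimal)
    show "?x ` S \<subseteq> augmentation_ideal A"
      unfolding augmentation_ideal_def
      by (rule order.trans[OF _ R.genideal_self]) (use S xc in auto)
  qed (rule augmentation_ideal_ideal[OF assms(1)])
  ultimately show ?thesis by blast
qed

text \<open>Every coefficient of the multiple has the form \<open>n m\<close>, so every factor of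
  the product defining the action is a power of some \<open>b [^] n = \<one>\<close>.\<close>

lemma group_ring_act_cmul_exponent:
  assumes "comm_group A" "comm_group B" and f: "f \<in> carrier A \<rightarrow> carrier B"
    and n: "n > 0" "\<And>b. b \<in> carrier B \<Longrightarrow> b [^]\<^bsub>B\<^esub> (n::nat) = \<one>\<^bsub>B\<^esub>"
    and z: "Poly_Mapping.keys z \<subseteq> carrier A" and x: "x \<in> carrier A"
  shows "group_ring_act A B (frag_cmul (int n) z) f x = \<one>\<^bsub>B\<^esub>"
proof -
  interpret A: comm_group A by fact
  interpret B: comm_group B by fact
  have "f (x \<otimes>\<^bsub>A\<^esub> a) [^]\<^bsub>B\<^esub> (int n * m) = \<one>\<^bsub>B\<^esub>" if "a \<in> carrier A" for a m
  proof -
    have b: "f (x \<otimes>\<^bsub>A\<^esub> a) \<in> carrier B" using f x that by auto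
    then have "f (x \<otimes>\<^bsub>A\<^esub> a) [^]\<^bsub>B\<^esub> (int n * m) = (f (x \<otimes>\<^bsub>A\<^esub> a) [^]\<^bsub>B\<^esub> n) [^]\<^bsub>B\<^esub> m"
      by (simp add: B.int_pow_pow flip: int_pow_int)
    then show ?thesis using n(2)[OF b] by simp
  qed
  then show ?thesis
    unfolding group_ring_act_def using z n(1) by (intro B.finprod_one_eqI) auto
qed

section \<open>Products of cyclic groups and their standard generators\<close>

lemma comm_group_product_integer_mod_group:
  "comm_group (product_group I (\<lambda>i. integer_mod_group (q i)))"
proof (rule group.group_comm_groupI)
  show "group (product_group I (\<lambda>i. integer_mod_group (q i)))"
    by (rule product_group) (rule group_integer_mod_group)
  fix x y :: "'a \<Rightarrow> int"
  show "x \<otimes>\<^bsub>product_group I (\<lambda>i. integer_mod_group (q i))\<^esub> y =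
      y \<otimes>\<^bsub>product_group I (\<lambda>i. integer_mod_group (q i))\<^esub> x"
    unfolding mult_product_group mult_integer_mod_group by (rule restrict_ext) (simp only: add.commute)
qed

text \<open>The reduction modulo \<open>q i\<close> matters for \<open>q i = 1\<close>, where \<open>1\<close> is not in the carrier.\<close>
definition single_mod :: "'i set \<Rightarrow> ('i \<Rightarrow> nat) \<Rightarrow> 'i \<Rightarrow> int \<Rightarrow> 'i \<Rightarrow> int" where
  "single_mod I q i z = (\<lambda>j\<in>I. if j = i then z mod int (q i) else 0)"

lemma single_mod_carrier:
  assumes "\<And>i. i \<in> I \<Longrightarrow> 0 < q i"
  shows "single_mod I q i z \<in> carrier (product_group I (\<lambda>i. integer_mod_group (q i)))"
proof -
  have "(if j = i then z mod int (q i) else 0) \<in> carrier (integer_mod_group (q j))" if "j \<in> I" for j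
    using assms[OF that] by (auto simp: carrier_integer_mod_group)
  then show ?thesis unfolding single_mod_def by simp
qed

text \<open>Serves twice: with \<open>n = q i\<close> it shows that the \<open>q i\<close>-th power
  of the generator is trivial, and with other exponents it produces every residue in coordinate
  \<open>i\<close>.\<close>

lemma pow_single_mod:
  "single_mod I q i 1 [^]\<^bsub>product_group I (\<lambda>i. integer_mod_group (q i))\<^esub> n =
    single_mod I q i (int n)"
proof -
  interpret A: comm_group "product_group I (\<lambda>i. integer_mod_group (q i))"
    by (rule comm_group_product_integer_mod_group)
  show ?thesis
  proof (induction n)
    case (Suc n)
    have "(int n mod int (q i) + 1 mod int (q i)) mod int (q i) = int (Suc n) mod int (q i)"
      by (simp add: mod_add_eq add.commute)
    then show ?case
      unfolding A.nat_pow_Suc Suc by (auto simp: single_mod_def)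
  qed (auto simp: single_mod_def fun_eq_iff)
qed

text \<open>An element \<open>a\<close> is built up coordinate by coordinate: the induction is over
  the set \<open>T\<close> of coordinates already equal to those of \<open>a\<close>, all others
  being 0, and a new coordinate \<open>i\<close> is filled in by the \<open>a i\<close>-th power of
  its generator.\<close>

lemma generate_single_mod:
  assumes q: "\<And>i. i \<in> I \<Longrightarrow> 0 < q i" and "finite I"
  shows "generate (product_group I (\<lambda>i. integer_mod_group (q i)))
      ((\<lambda>i. single_mod I q i 1) ` I) =
    carrier (product_group I (\<lambda>i. integer_mod_group (q i)))" (is "generate ?A ?S = _")
proof -
  interpret A: comm_group ?A by (rule comm_group_product_integer_mod_group)
  have Sc: "?S \<subseteq> carrier ?A" using single_mod_carrier[of I q, OF q] by (auto simp del: carrier_product_group)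
  have pow: "s [^]\<^bsub>?A\<^esub> n \<in> generate ?A ?S" if "s \<in> ?S" for s and n :: nat
  proof (induction n)
    case 0
    show ?case unfolding A.nat_pow_0 by (rule generate.one)
  next
    case (Suc n)
    show ?case unfolding A.nat_pow_Suc by (rule generate.eng[OF Suc generate.incl[OF that]])
  qed
  have "a \<in> generate ?A ?S" if a: "a \<in> carrier ?A" for a
  proof -
    have "finite T \<Longrightarrow> T \<subseteq> I \<Longrightarrow> (\<lambda>j\<in>I. if j \<in> T then a j else 0) \<in> generate ?A ?S" for T
    proof (induction T rule: finite_induct)
      case empty
      have "(\<lambda>j\<in>I. if j \<in> {} then a j else 0) = \<one>\<^bsub>?A\<^esub>" by simp
      then show ?case using generate.one[of ?A ?S] by (simp only:)
    next
      case (insert i T)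
      have range: "0 \<le> a j" "a j < int (q j)" if "j \<in> I" for j
      proof -
        have "a j \<in> carrier (integer_mod_group (q j))"
          using a that unfolding carrier_product_group by (rule PiE_mem)
        then show "0 \<le> a j" "a j < int (q j)"
          using q[OF that] by (simp_all add: carrier_integer_mod_group)
      qed
      \<comment> \<open>The representative \<open>a i\<close> is nonnegative, so a power with
        natural exponent suffices.\<close>
      have "single_mod I q i (int (nat (a i))) \<in> generate ?A ?S"
        using insert.prems unfolding pow_single_mod[symmetric] by (intro pow) blast
      then have "single_mod I q i (a i) \<in> generate ?A ?S"
        using range[of i] insert.prems by (simp only: nat_0_le insert_subset)
      then have "single_mod I q i (a i) \<otimes>\<^bsub>?A\<^esub> (\<lambda>j\<in>I. if j \<in> T then a j else 0) \<in> generate ?A ?S"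
        using insert.IH insert.prems by (intro generate.eng) blast+
      moreover have "single_mod I q i (a i) \<otimes>\<^bsub>?A\<^esub> (\<lambda>j\<in>I. if j \<in> T then a j else 0) =
          (\<lambda>j\<in>I. if j \<in> insert i T then a j else 0)"
        unfolding mult_product_group mult_integer_mod_group
        by (rule restrict_ext) (use range insert.hyps in \<open>auto simp: single_mod_def\<close>)
      ultimately show ?case by (simp only:)
    qed
    from this[OF assms(2)] have "(\<lambda>j\<in>I. a j) \<in> generate ?A ?S"
      by (simp cong: restrict_cong)
    moreover have "(\<lambda>j\<in>I. a j) = a" using a by (simp add: PiE_restrict)
    ultimately show ?thesis by simp
  qed
  then show ?thesis using A.generate_incl[OF Sc] by blast
qed

section \<open>The degree bound for products of cyclic \<open>p\<close>-groups\<close>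

theorem lemma8p1:
  fixes p k \<beta> :: nat
    and \<alpha> :: "nat \<Rightarrow> nat"
    and A :: "(nat \<Rightarrow> int) monoid"
    and B :: "('b, 'm) monoid_scheme"
    and f :: "(nat \<Rightarrow> int) \<Rightarrow> 'b"
  assumes "Factorial_Ring.prime p"
    and "k \<ge> 1"
    and "A = product_group {1..k} (\<lambda>i. integer_mod_group (p ^ \<alpha> i))"
    and "comm_group B"
    and "has_exponent B (p ^ \<beta>)"
    and "f \<in> carrier A \<rightarrow> carrier B"
  shows "Fdeg A B f \<le> enat (\<beta> * (\<Sum>i = 1..k. p ^ \<alpha> i - 1))"
proof -
  let ?q = "\<lambda>i. p ^ \<alpha> i" and ?M = "\<Sum>i = 1..k. p ^ \<alpha> i - 1"
  let ?R = "group_ring A" and ?I = "augmentation_ideal A"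
  let ?e = "\<lambda>i. single_mod {1..k} ?q i 1"
  define x where "x i = frag_of (?e i) - frag_of \<one>\<^bsub>A\<^esub>" for i
  have q: "0 < ?q i" for i using assms(1) by (simp add: prime_gt_0_nat)
  have A: "comm_group A" unfolding assms(3) by (rule comm_group_product_integer_mod_group)
  interpret A: comm_group A by fact
  interpret R: cring ?R by (rule cring_group_ring) fact
  interpret I: ideal ?I ?R by (rule augmentation_ideal_ideal) fact
  have ec: "?e i \<in> carrier A" for i unfolding assms(3) by (rule single_mod_carrier) (rule q)
  have xc: "x \<in> {1..k} \<rightarrow> carrier ?R"
    using augmentation_generator_carrier[OF A ec] by (simp add: x_def)
  have I_eq: "?I = Idl\<^bsub>?R\<^esub> (x ` {1..k})"
  proof -
    have "generate A (?e ` {1..k}) = carrier A"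
      unfolding assms(3) by (rule generate_single_mod) (use q in auto)
    moreover have "?e ` {1..k} \<subseteq> carrier A" using ec by blast
    ultimately show ?thesis
      using augmentation_ideal_eq_genideal[OF A] by (simp add: image_image x_def)
  qed
  have xI: "x i \<in> ?I" if "i \<in> {1..k}" for i
    unfolding I_eq using that xc by (intro subsetD[OF R.genideal_self]) auto
  have xq: "x i [^]\<^bsub>?R\<^esub> ?q i \<in> add_pow ?R p ` ?I" if i: "i \<in> {1..k}" for i
  proof (rule R.pow_prime_power_in_add_pow_image[OF assms(1) I.is_ideal xI[OF i]])
    \<comment> \<open>Since \<open>x i\<close> plus the unit is the basis element of
      \<open>?e i\<close>, the hypothesis on its \<open>?q i\<close>-th power reduces to the order
      of the group element.\<close>
    have "?e i [^]\<^bsub>A\<^esub> ?q i = \<one>\<^bsub>A\<^esub>"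
      unfolding assms(3) pow_single_mod by (auto simp: single_mod_def fun_eq_iff)
    then have "frag_of (?e i) [^]\<^bsub>?R\<^esub> ?q i = \<one>\<^bsub>?R\<^esub>"
      using pow_group_ring_basis[OF A ec] by (simp add: one_group_ring)
    then show "(x i \<oplus>\<^bsub>?R\<^esub> \<one>\<^bsub>?R\<^esub>) [^]\<^bsub>?R\<^esub> ?q i = \<one>\<^bsub>?R\<^esub>"
      by (simp add: x_def add_group_ring one_group_ring)
  qed
  \<comment> \<open>\<open>Suc ?M\<close> is the least length that exceeds the pigeonhole bound for
    the exponents \<open>?q i\<close>.\<close>
  have step: "foldr (\<otimes>\<^bsub>?R\<^esub>) zs \<one>\<^bsub>?R\<^esub> \<in> add_pow ?R p ` ?I"
    if "set zs \<subseteq> ?I" "length zs = Suc ?M" for zs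
    by (rule R.prod_in_ideal_pigeonhole[OF _ xc R.add_pow_image_ideal[OF I.is_ideal] xq])
      (use that I_eq in auto)
  \<comment> \<open>The exponent is the \<open>n + 1\<close> from \<open>Fdeg\<close> at
    \<open>n = \<beta> * ?M\<close>, and equals the length \<open>Suc (j * M)\<close> of the
    iteration at \<open>j = \<beta>\<close>. Only the generating products need checking, because the
    target is an ideal.\<close>
  have "ideal_power ?R ?I (\<beta> * ?M + 1) \<subseteq> add_pow ?R (p ^ \<beta>) ` ?I"
    unfolding ideal_power_def
    using R.prod_in_add_pow_image_iterate[OF I.is_ideal step]
    by (intro R.genideal_minimal R.add_pow_image_ideal[OF I.is_ideal]) auto
  moreover have "group_ring_act A B j f y = \<one>\<^bsub>B\<^esub>"
    if "j \<in> add_pow ?R (p ^ \<beta>) ` ?I" "y \<in> carrier A" for j y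
  proof -
    obtain z where z: "z \<in> ?I" "j = frag_cmul (int (p ^ \<beta>)) z"
      using \<open>j \<in> add_pow ?R (p ^ \<beta>) ` ?I\<close> by (auto simp: add_pow_group_ring[OF A])
    have "Poly_Mapping.keys z \<subseteq> carrier A"
      using I.Icarr[OF z(1)] by (simp add: carrier_group_ring)
    then show ?thesis
      unfolding z(2) using assms(4-6) A that(2)
      by (intro group_ring_act_cmul_exponent) (simp_all add: has_exponent_def)
  qed
  ultimately have "annihilates A B (ideal_power ?R ?I (\<beta> * ?M + 1)) f"
    unfolding annihilates_def by blast
  \<comment> \<open>\<open>Fdeg\<close> is an infimum, so one annihilating power bounds it from
    above.\<close>
  then show ?thesis
    unfolding Fdeg_def by (intro Inf_lower) blast
qed

end
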